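(* Let $c>-1$, let $\mathcal{G}\subset\mathrm{O}(m)$ be the finite reflection group of a reduced root system $R$ with multiplicity function $\kappa\ge0$, and let $\widetilde{\mathcal{G}}=p^{-1}(\mathcal{G})\subset\mathrm{Pin}(m)$. Let $s\in\widetilde{\mathcal{G}}$ and define $\mathrm{sgn}(s):=\mathrm{sgn}(p(s))$ (the determinant of $p(s)\in\mathrm{O}(m)$). Then $$\rho(s)\,\underline{x}=\mathrm{sgn}(s)\,\underline{x}\,\rho(s),\qquad \rho(s)\,\mathbf{D}=\mathrm{sgn}(s)\,\mathbf{D}\,\rho(s)$$ as operators on smooth $\mathcal{C}l_m$-valued functions (the results being regarded as functions on $\mathbb{R}^m\setminus\{0\}$).
   Context: $\mathcal{C}l_m$ is the real associative Clifford algebra generated by $e_1,\dots,e_m$ with $e_ie_j+e_je_i=0$ ($i\neq j$), $e_i^2=-1$. A vector $x\in\mathbb{R}^m$ is identified with $\underline{x}=\sum_ie_ix_i$; $r=|x|$. $\epsilon$ is the automorphism of $\mathcal{C}l_m$ with $\epsilon(e_i)=-e_i$. $\mathrm{Pin}(m)$ is the group of products $s_1\cdots s_n$ of vectors $s_i$ with $s_i^2=-1$; the double cover $p:\mathrm{Pin}(m)\to\mathrm{O}(m)$ is $p(s)(x)=\epsilon(s)\,\underline{x}\,s^{-1}$. $R\subset\mathbb{R}^m\setminus\{0\}$ is a reduced root system normalized by $\langle\alpha,\alpha\rangle=2$, $R_+$ a positive subsystem, $r_\alpha(x)=x-2\frac{\langle\alpha,x\rangle}{|\alpha|^2}\alpha$,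 $\mathcal{G}$ the group generated by the $r_\alpha$, $\alpha\in R$, and $\kappa:R\to[0,\infty)$ is $\mathcal{G}$-invariant, $\kappa_\alpha=\kappa(\alpha)$. The Dunkl operators are $$T_if(x)=\partial_{x_i}f(x)+\sum_{\alpha\in R_+}\kappa_\alpha\alpha_i\frac{f(x)-f(r_\alpha(x))}{\langle\alpha,x\rangle},$$ acting coefficientwise on $\mathcal{C}l_m$-valued functions. $\mathcal{D}_\kappa=\sum_ie_iT_i$, $\mathbb{E}=\sum_ix_i\partial_{x_i}$, and $\mathbf{D}=\mathcal{D}_\kappa+c\,r^{-2}\underline{x}\,\mathbb{E}$ (Clifford elements act by left multiplication). The action $\rho$ of $\mathrm{Pin}(m)$ on $C^\infty(\mathbb{R}^m)\otimes\mathcal{C}l_m$ (and by the same formula on functions on $\mathbb{R}^m\setminus\{0\}$) is $\rho(s)(f\otimes b)=f(p(s^{-1})x)\otimes sb$. *)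

theory Defs
  imports "HOL-Analysis.Analysis" "HOL-Algebra.Bij" "HOL-Algebra.Generated_Groups"
begin

section \<open>The real Clifford algebra with negative definite generators\<close>

text \<open>
  The finite, linearly ordered index type plays the role of the index set of the generators.
  An element is stored by its coordinates with respect to the basis of ordered monomials
  \<open>e\<^sub>A = e\<^bsub>i\<^sub>1\<^esub> \<cdots> e\<^bsub>i\<^sub>k\<^esub>\<close>, for \<open>A = {i\<^sub>1 < \<dots> < i\<^sub>k}\<close>.
\<close>

typedef (overloaded) 'm clifford = "UNIV :: (real ^ ('m::finite set)) set"
  morphisms cl_coeffs of_cl_coeffs
  by simp

setup_lifting type_definition_clifford

instantiation clifford :: (finite) euclidean_space
begin

lift_definition zero_clifford :: "'a clifford" is 0 .
lift_definition plus_clifford :: "'a clifford \<Rightarrow> 'a clifford \<Rightarrow> 'a clifford" is "(+)" .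
lift_definition minus_clifford :: "'a clifford \<Rightarrow> 'a clifford \<Rightarrow> 'a clifford" is "(-)" .
lift_definition uminus_clifford :: "'a clifford \<Rightarrow> 'a clifford" is uminus .
lift_definition scaleR_clifford :: "real \<Rightarrow> 'a clifford \<Rightarrow> 'a clifford" is scaleR .
lift_definition inner_clifford :: "'a clifford \<Rightarrow> 'a clifford \<Rightarrow> real" is inner .
lift_definition norm_clifford :: "'a clifford \<Rightarrow> real" is norm .
lift_definition sgn_clifford :: "'a clifford \<Rightarrow> 'a clifford" is sgn .
lift_definition dist_clifford :: "'a clifford \<Rightarrow> 'a clifford \<Rightarrow> real" is dist .
lift_definition Basis_clifford :: "'a clifford set" is Basis .

definition uniformity_clifford :: "('a clifford \<times> 'a clifford) filter"
  where "uniformity_clifford = (INF e\<in>{0 <..}. principal {(x, y). dist x y < e})"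

definition open_clifford :: "'a clifford set \<Rightarrow> bool"
  where "open_clifford U = (\<forall>x\<in>U. eventually (\<lambda>(x', y). x' = x \<longrightarrow> y \<in> U) uniformity)"

instance
proof
  fix x y z :: "'a clifford" and a b :: real and U :: "'a clifford set"
  show "x + y + z = x + (y + z)" by transfer simp
  show "x + y = y + x" by transfer simp
  show "0 + x = x" by transfer simp
  show "- x + x = 0" by transfer simp
  show "x - y = x + - y" by transfer simp
  show "a *\<^sub>R (x + y) = a *\<^sub>R x + a *\<^sub>R y" by transfer (simp add: scaleR_add_right)
  show "(a + b) *\<^sub>R x = a *\<^sub>R x + b *\<^sub>R x" by transfer (simp add: scaleR_add_left)
  show "a *\<^sub>R b *\<^sub>R x = (a * b) *\<^sub>R x" by transfer simp
  show "1 *\<^sub>R x = x" by transfer simp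
  show "sgn x = inverse (norm x) *\<^sub>R x" by transfer (simp add: sgn_div_norm)
  show "dist x y = norm (x - y)" by transfer (simp add: dist_norm)
  show "uniformity = (INF e\<in>{0 <..}. principal {(x, y :: 'a clifford). dist x y < e})"
    by (rule uniformity_clifford_def)
  show "open U = (\<forall>x\<in>U. eventually (\<lambda>(x', y). x' = x \<longrightarrow> y \<in> U) uniformity)"
    by (rule open_clifford_def)
  show "inner x y = inner y x" by transfer (rule inner_commute)
  show "inner (x + y) z = inner x z + inner y z" by transfer (rule inner_add_left)
  show "inner (a *\<^sub>R x) y = a * inner x y" by transfer simp
  show "0 \<le> inner x x" by transfer simp
  show "inner x x = 0 \<longleftrightarrow> x = 0" by transfer simp
  show "norm x = sqrt (inner x x)" by transfer (rule norm_eq_sqrt_inner)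
  show "(Basis :: 'a clifford set) \<noteq> {}" by transfer simp
  show "finite (Basis :: 'a clifford set)" by transfer simp
  show "(\<forall>u\<in>Basis. inner x u = 0) \<longleftrightarrow> x = 0" by transfer (rule euclidean_all_zero_iff)
next
  fix u v :: "'a clifford"
  assume "u \<in> Basis" "v \<in> Basis"
  then show "inner u v = (if u = v then 1 else 0)"
    by transfer (rule inner_Basis)
qed

end

text \<open>
  Sorting the product of two ordered monomials gives
  \<open>e\<^sub>A e\<^sub>B = blade_sign A B e\<^sub>C\<close> with \<open>C\<close> the symmetric difference of \<open>A\<close> and \<open>B\<close>:
  each pair \<open>i \<in> A\<close>, \<open>j \<in> B\<close> with \<open>j < i\<close> contributes a sign for an exchange,
  and each pair with \<open>j = i\<close> a sign for \<open>e\<^sub>i\<^sup>2 = -1\<close>.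
\<close>

definition blade_sign :: "'m::{finite,linorder} set \<Rightarrow> 'm set \<Rightarrow> real" where
  "blade_sign A B = (-1) ^ card {(i, j). i \<in> A \<and> j \<in> B \<and> j \<le> i}"

definition blade :: "'m::finite set \<Rightarrow> 'm clifford" where
  "blade A = of_cl_coeffs (axis A 1)"

lemma blade_sign_altdef:
  "blade_sign A B = (\<Prod>i\<in>A. \<Prod>j\<in>B. if j \<le> i then - 1 else 1)"
proof -
  have "(\<Prod>i\<in>A. \<Prod>j\<in>B. if j \<le> i then - 1 else 1 :: real)
      = (\<Prod>(i, j)\<in>A \<times> B. if j \<le> i then - 1 else 1)"
    by (simp add: prod.cartesian_product)
  also have "\<dots> = (\<Prod>p\<in>{(i, j). i \<in> A \<and> j \<in> B \<and> j \<le> i}. - 1)"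
    by (rule prod.mono_neutral_cong_right) (auto split: if_splits)
  finally show ?thesis
    by (simp add: blade_sign_def)
qed

lemma prod_sym_diff_sign:
  fixes f :: "'a::finite \<Rightarrow> real"
  assumes "\<And>i. f i * f i = 1"
  shows "prod f (sym_diff A B) = prod f A * prod f B"
proof -
  have sq: "prod f (A \<inter> B) * prod f (A \<inter> B) = 1"
    by (simp add: prod.distrib[symmetric] assms)
  have A: "prod f A = prod f (A - B) * prod f (A \<inter> B)"
    by (subst prod.union_disjoint[symmetric]) (auto intro: prod.cong)
  have B: "prod f B = prod f (B - A) * prod f (A \<inter> B)"
    by (subst prod.union_disjoint[symmetric]) (auto intro: prod.cong)
  have "prod f (sym_diff A B) = prod f (A - B) * prod f (B - A)"
    by (rule prod.union_disjoint) auto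
  then show ?thesis
    unfolding A B using sq by (simp add: algebra_simps)
qed

lemma blade_sign_sym_diff_left:
  "blade_sign (sym_diff A B) C = blade_sign A C * blade_sign B C"
  unfolding blade_sign_altdef
  by (rule prod_sym_diff_sign) (unfold prod.distrib[symmetric], rule prod.neutral, simp)

lemma blade_sign_sym_diff_right:
  "blade_sign A (sym_diff B C) = blade_sign A B * blade_sign A C"
  unfolding blade_sign_altdef
  by (subst prod_sym_diff_sign) (auto simp: prod.distrib)

lemma blade_sign_square: "blade_sign A B * blade_sign A B = 1"
  by (simp add: blade_sign_def flip: power_mult_distrib)

lemma sym_diff_left_eq_iff: "sym_diff A B = C \<longleftrightarrow> B = sym_diff A C"
  by blast

lemma bij_sym_diff: "bij (sym_diff A)"
  by (rule o_bij[of "sym_diff A"]) auto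

instantiation clifford :: ("{finite,linorder}") real_algebra_1
begin

lift_definition one_clifford :: "'a clifford" is "axis {} 1" .

lift_definition times_clifford :: "'a clifford \<Rightarrow> 'a clifford \<Rightarrow> 'a clifford" is
  "\<lambda>a b. \<chi> C. \<Sum>A\<in>UNIV. \<Sum>B | sym_diff A B = C. blade_sign A B * (a $ A * b $ B)" .

lemma coeffs_times:
  "cl_coeffs (a * b) $ C
    = (\<Sum>A\<in>UNIV. blade_sign A (sym_diff A C) * (cl_coeffs a $ A * cl_coeffs b $ sym_diff A C))"
  by transfer (simp add: sym_diff_left_eq_iff)

instance
proof
  fix a b c :: "'a clifford" and t :: real
  show "(0 :: 'a clifford) \<noteq> 1"
    by transfer (simp add: vec_eq_iff axis_def)
  show "(a + b) * c = a * c + b * c"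
    by transfer (simp add: vec_eq_iff algebra_simps sum.distrib)
  show "a * (b + c) = a * b + a * c"
    by transfer (simp add: vec_eq_iff algebra_simps sum.distrib)
  show "t *\<^sub>R a * b = t *\<^sub>R (a * b)"
    by transfer (simp add: vec_eq_iff sum_distrib_left algebra_simps)
  show "a * t *\<^sub>R b = t *\<^sub>R (a * b)"
    by transfer (simp add: vec_eq_iff sum_distrib_left algebra_simps)
  show "1 * a = a"
    by (simp add: cl_coeffs_inject[symmetric] vec_eq_iff coeffs_times one_clifford.rep_eq axis_def
        blade_sign_def if_distrib if_distribR cong: if_cong)
  have unit: "cl_coeffs (a * 1) $ C = cl_coeffs a $ C" for C
  proof -
    have "cl_coeffs (a * 1) $ C = (\<Sum>A\<in>UNIV. if A = C then cl_coeffs a $ C else 0)"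
      unfolding coeffs_times
      by (rule sum.cong) (auto simp: one_clifford.rep_eq axis_def blade_sign_def)
    then show ?thesis by simp
  qed
  then show "a * 1 = a"
    by (simp add: cl_coeffs_inject[symmetric] vec_eq_iff)
  have "cl_coeffs (a * b * c) $ D = cl_coeffs (a * (b * c)) $ D" for D
  proof -
    let ?s = blade_sign and ?d = "\<lambda>A B :: 'a set. sym_diff A B"
    have "cl_coeffs (a * b * c) $ D = (\<Sum>E\<in>UNIV. \<Sum>A\<in>UNIV.
        ?s E (?d E D) * ?s A (?d A E) * (cl_coeffs a $ A * cl_coeffs b $ ?d A E * cl_coeffs c $ ?d E D))"
      by (simp add: coeffs_times sum_distrib_left sum_distrib_right algebra_simps)
    also have "\<dots> = (\<Sum>A\<in>UNIV. \<Sum>E\<in>UNIV.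
        ?s E (?d E D) * ?s A (?d A E) * (cl_coeffs a $ A * cl_coeffs b $ ?d A E * cl_coeffs c $ ?d E D))"
      by (rule sum.swap)
    also have "\<dots> = (\<Sum>A\<in>UNIV. \<Sum>B\<in>UNIV.
        ?s A (?d A D) * ?s B (?d B (?d A D))
          * (cl_coeffs a $ A * cl_coeffs b $ B * cl_coeffs c $ ?d B (?d A D)))"
    proof (rule sum.cong[OF refl])
      fix A
      have "(\<Sum>E\<in>UNIV.
          ?s E (?d E D) * ?s A (?d A E) * (cl_coeffs a $ A * cl_coeffs b $ ?d A E * cl_coeffs c $ ?d E D))
        = (\<Sum>B\<in>UNIV. ?s (?d A B) (?d (?d A B) D) * ?s A (?d A (?d A B))
            * (cl_coeffs a $ A * cl_coeffs b $ ?d A (?d A B) * cl_coeffs c $ ?d (?d A B) D))"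
        by (rule sum.reindex_bij_betw[OF bij_sym_diff, symmetric])
      also have "\<dots> = (\<Sum>B\<in>UNIV. ?s A (?d A D) * ?s B (?d B (?d A D))
          * (cl_coeffs a $ A * cl_coeffs b $ B * cl_coeffs c $ ?d B (?d A D)))"
      proof (rule sum.cong[OF refl])
        fix B
        have e1: "?d A (?d A B) = B" and e2: "?d (?d A B) D = ?d B (?d A D)" by auto
        have "?s (?d A B) (?d B (?d A D)) * ?s A B = ?s A (?d A D) * ?s B (?d B (?d A D))"
          using blade_sign_square[of A B]
          by (simp only: blade_sign_sym_diff_left blade_sign_sym_diff_right) algebra
        then show "?s (?d A B) (?d (?d A B) D) * ?s A (?d A (?d A B))
            * (cl_coeffs a $ A * cl_coeffs b $ ?d A (?d A B) * cl_coeffs c $ ?d (?d A B) D)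
          = ?s A (?d A D) * ?s B (?d B (?d A D))
            * (cl_coeffs a $ A * cl_coeffs b $ B * cl_coeffs c $ ?d B (?d A D))"
          by (simp only: e1 e2)
      qed
      finally show "(\<Sum>E\<in>UNIV.
          ?s E (?d E D) * ?s A (?d A E) * (cl_coeffs a $ A * cl_coeffs b $ ?d A E * cl_coeffs c $ ?d E D))
        = (\<Sum>B\<in>UNIV. ?s A (?d A D) * ?s B (?d B (?d A D))
          * (cl_coeffs a $ A * cl_coeffs b $ B * cl_coeffs c $ ?d B (?d A D)))" .
    qed
    also have "\<dots> = cl_coeffs (a * (b * c)) $ D"
      by (simp only: coeffs_times sum_distrib_left) (simp only: ac_simps)
    finally show ?thesis .
  qed
  then show "a * b * c = a * (b * c)"
    by (simp add: cl_coeffs_inject[symmetric] vec_eq_iff)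
qed

end

lemma coeffs_sum: "cl_coeffs (sum f S) = (\<Sum>x\<in>S. cl_coeffs (f x))"
  by (induction S rule: infinite_finite_induct)
    (simp_all add: zero_clifford.rep_eq plus_clifford.rep_eq)

lemma coeffs_blade: "cl_coeffs (blade A) $ B = (if B = A then 1 else 0)"
  by (simp add: blade_def of_cl_coeffs_inverse axis_def)

lemma clifford_eq_sum_blade: "a = (\<Sum>A\<in>UNIV. cl_coeffs a $ A *\<^sub>R blade A)"
  by (simp add: cl_coeffs_inject[symmetric] coeffs_sum scaleR_clifford.rep_eq vec_eq_iff coeffs_blade
      if_distrib cong: if_cong)

lemma blade_times_blade: "blade A * blade B = blade_sign A B *\<^sub>R blade (sym_diff A B)"
proof -
  have "cl_coeffs (blade A * blade B) $ C = blade_sign A B * (if C = sym_diff A B then 1 else 0)" for C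
  proof -
    have "cl_coeffs (blade A * blade B) $ C
      = (\<Sum>A'\<in>UNIV. if A' = A then blade_sign A B * (if C = sym_diff A B then 1 else 0) else 0)"
      unfolding coeffs_times coeffs_blade by (rule sum.cong) auto
    then show ?thesis by simp
  qed
  then show ?thesis
    by (simp add: cl_coeffs_inject[symmetric] vec_eq_iff scaleR_clifford.rep_eq coeffs_blade)
qed

definition gen :: "'m::finite \<Rightarrow> 'm clifford" where
  "gen i = blade {i}"

lemma blade_empty: "blade {} = 1"
  by (simp add: blade_def one_clifford_def)

lemma gen_square: "gen i * gen i = - 1"
  by (simp add: gen_def blade_times_blade blade_empty blade_sign_altdef)

lemma gen_anticommute: "i \<noteq> j \<Longrightarrow> gen i * gen j + gen j * gen i = 0"
  by (auto simp: gen_def blade_times_blade blade_sign_altdef insert_commute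
      insert_Diff_if not_le order.order_iff_strict)

lemma blade_insert_less:
  assumes "\<forall>j\<in>A. i < j"
  shows "blade (insert i A) = gen i * blade A"
proof -
  have "i \<notin> A" and "\<forall>j\<in>A. \<not> j \<le> i" using assms by auto
  then have "sym_diff {i} A = insert i A" and "blade_sign {i} A = 1"
    by (auto simp: blade_sign_altdef)
  then show ?thesis by (simp add: gen_def blade_times_blade)
qed

lemma blade_eq_prod_list: "blade A = prod_list (map gen (sorted_list_of_set A))"
proof -
  have "sorted xs \<Longrightarrow> distinct xs \<Longrightarrow> blade (set xs) = prod_list (map gen xs)"
    for xs :: "'a list"
  proof (induction xs)
    case (Cons x xs)
    then have "\<forall>j\<in>set xs. x < j" by (auto simp: order.strict_iff_order)
    with Cons show ?case by (simp add: blade_insert_less)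
  qed (simp add: blade_empty)
  from this[of "sorted_list_of_set A"] show ?thesis by simp
qed

definition vec_cl :: "real ^ 'm \<Rightarrow> 'm::finite clifford" where
  "vec_cl x = (\<Sum>i\<in>UNIV. (x $ i) *\<^sub>R gen i)"

definition main_aut :: "'m::finite clifford \<Rightarrow> 'm clifford" where
  "main_aut a = (\<Sum>A\<in>UNIV. ((-1) ^ card A * cl_coeffs a $ A) *\<^sub>R blade A)"

lemma coeffs_main_aut: "cl_coeffs (main_aut a) $ A = (-1) ^ card A * cl_coeffs a $ A"
  by (simp add: main_aut_def coeffs_sum scaleR_clifford.rep_eq coeffs_blade
      if_distrib cong: if_cong)

lemma linear_main_aut: "linear main_aut"
  by (rule linearI)
    (simp_all add: cl_coeffs_inject[symmetric] vec_eq_iff coeffs_main_aut plus_clifford.rep_eq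
      scaleR_clifford.rep_eq algebra_simps)

lemma main_aut_one: "main_aut 1 = 1"
  by (simp add: cl_coeffs_inject[symmetric] vec_eq_iff coeffs_main_aut one_clifford.rep_eq axis_def)

lemma main_aut_gen: "main_aut (gen i) = - gen i"
  by (simp add: cl_coeffs_inject[symmetric] vec_eq_iff coeffs_main_aut gen_def coeffs_blade
      uminus_clifford.rep_eq)

lemma main_aut_times: "main_aut (a * b) = main_aut a * main_aut b"
proof -
  have sgn: "(-1) ^ card C = (-1) ^ card A * (-1 :: real) ^ card (sym_diff A C)"
    for A C :: "'a set"
  proof -
    have "sym_diff A (sym_diff A C) = C" by blast
    with prod_sym_diff_sign[of "\<lambda>_. - 1" A "sym_diff A C"] show ?thesis
      by (simp only: prod_constant)
  qed
  have "cl_coeffs (main_aut (a * b)) $ C = cl_coeffs (main_aut a * main_aut b) $ C" for C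
    unfolding coeffs_main_aut coeffs_times sum_distrib_left
  proof (rule sum.cong[OF refl])
      fix A
      show "(-1) ^ card C * (blade_sign A (sym_diff A C) * (cl_coeffs a $ A * cl_coeffs b $ sym_diff A C))
        = blade_sign A (sym_diff A C) * ((-1) ^ card A * cl_coeffs a $ A
          * ((-1) ^ card (sym_diff A C) * cl_coeffs b $ sym_diff A C))"
        unfolding sgn[of C A] by (simp only: ac_simps)
  qed
  then show ?thesis
    by (simp add: cl_coeffs_inject[symmetric] vec_eq_iff)
qed

section \<open>The Pin group and its covering map\<close>

definition Pin :: "'m::{finite,linorder} clifford set" where
  "Pin = {prod_list ss | ss. \<forall>s\<in>set ss. s \<in> range vec_cl \<and> s * s = - 1}"

definition cl_inv :: "'m::{finite,linorder} clifford \<Rightarrow> 'm clifford" where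
  "cl_inv s = (THE t. s * t = 1 \<and> t * s = 1)"

lemma cl_inv_eqI:
  assumes "s * t = 1" "t * s = 1"
  shows "cl_inv s = t"
  unfolding cl_inv_def
proof (rule the_equality)
  fix u assume "s * u = 1 \<and> u * s = 1"
  then have "u = t * s * u" using assms by simp
  also have "\<dots> = t" using \<open>s * u = 1 \<and> u * s = 1\<close> by (simp add: mult.assoc)
  finally show "u = t" .
qed (use assms in simp)

definition pin_cover :: "'m::{finite,linorder} clifford \<Rightarrow> (real, 'm) vec \<Rightarrow> (real, 'm) vec" where
  "pin_cover s x = (THE y. vec_cl y = main_aut s * vec_cl x * cl_inv s)"

lemma vec_cl_nth: "cl_coeffs (vec_cl x) $ {i} = x $ i"
  by (simp add: vec_cl_def gen_def coeffs_sum scaleR_clifford.rep_eq coeffs_blade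
      if_distrib cong: if_cong)

lemma inj_vec_cl: "inj vec_cl"
  by (rule injI) (metis vec_cl_nth vec_eq_iff)

lemma linear_vec_cl: "linear vec_cl"
  by (rule linearI)
    (simp_all add: vec_cl_def scaleR_add_left sum.distrib scaleR_sum_right)

lemma main_aut_vec_cl: "main_aut (vec_cl x) = - vec_cl x"
  by (simp add: vec_cl_def linear_sum[OF linear_main_aut] linear_scale[OF linear_main_aut]
      main_aut_gen sum_negf)

lemma vec_cl_anticommutator:
  "vec_cl x * vec_cl y + vec_cl y * vec_cl x = (- 2 * (x \<bullet> y)) *\<^sub>R 1"
proof -
  have "vec_cl x * vec_cl y + vec_cl y * vec_cl x
      = (\<Sum>i\<in>UNIV. \<Sum>j\<in>UNIV. (x $ i * y $ j) *\<^sub>R (gen i * gen j + gen j * gen i))"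
    unfolding vec_cl_def sum_product
    by (subst (2) sum.swap) (simp add: sum.distrib scaleR_add_right mult.commute)
  also have "\<dots> = (\<Sum>i\<in>UNIV. \<Sum>j\<in>UNIV. if j = i then (- 2 * (x $ i * y $ i)) *\<^sub>R 1 else 0)"
    by (intro sum.cong refl) (auto simp: gen_anticommute gen_square simp flip: scaleR_2)
  also have "\<dots> = (- 2 * (x \<bullet> y)) *\<^sub>R 1"
    by (simp add: inner_vec_def sum_distrib_left scaleR_sum_left sum_negf)
  finally show ?thesis .
qed

lemma Pin_invertible:
  assumes "s \<in> Pin"
  shows "s * cl_inv s = 1" "cl_inv s * s = 1"
proof -
  have "\<exists>t. prod_list ss * t = 1 \<and> t * prod_list ss = 1" if "\<forall>s\<in>set ss. s * s = - 1"
    for ss :: "'a clifford list"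
    using that
  proof (induction ss)
    case (Cons v ss)
    then obtain t where t: "prod_list ss * t = 1" "t * prod_list ss = 1" by auto
    from Cons.prems have v: "v * v = - 1" by simp
    have "v * prod_list ss * (t * (- v)) = v * (prod_list ss * t) * (- v)"
      by (simp add: mult.assoc)
    moreover have "t * (- v) * (v * prod_list ss) = t * (- (v * v)) * prod_list ss"
      by (simp add: mult.assoc)
    ultimately have "prod_list (v # ss) * (t * (- v)) = 1 \<and> t * (- v) * prod_list (v # ss) = 1"
      using t v by simp
    then show ?case by blast
  qed simp
  with assms obtain t where "s * t = 1" "t * s = 1" unfolding Pin_def by fastforce
  with cl_inv_eqI[of s t] show "s * cl_inv s = 1" "cl_inv s * s = 1" by simp_all
qed

lemma vec_cl_pin_cover:
  assumes "s \<in> Pin"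
  shows "vec_cl (pin_cover s x) = main_aut s * vec_cl x * cl_inv s"
proof -
  have "\<exists>y. main_aut (prod_list ss) * vec_cl x = vec_cl y * prod_list ss"
    if "\<forall>s\<in>set ss. s \<in> range vec_cl \<and> s * s = - 1" for ss
    using that
  proof (induction ss)
    case (Cons v ss)
    then obtain y where y: "main_aut (prod_list ss) * vec_cl x = vec_cl y * prod_list ss" by auto
    from Cons.prems obtain a where a: "v = vec_cl a" "v * v = - 1" by auto
    define z where "z = y - (2 * (a \<bullet> y)) *\<^sub>R a"
    have "v * vec_cl y = (- 2 * (a \<bullet> y)) *\<^sub>R 1 - vec_cl y * v"
      using vec_cl_anticommutator[of a y] a(1) by (simp add: algebra_simps)
    moreover have "vec_cl z * v = vec_cl y * v + (2 * (a \<bullet> y)) *\<^sub>R 1"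
      using a by (simp add: z_def linear_diff[OF linear_vec_cl] linear_scale[OF linear_vec_cl]
          left_diff_distrib)
    ultimately have "- v * vec_cl y = vec_cl z * v" by simp
    then have "main_aut (prod_list (v # ss)) * vec_cl x = vec_cl z * prod_list (v # ss)"
      using y a(1) by (simp add: main_aut_times main_aut_vec_cl mult.assoc)
        (metis minus_mult_left mult.assoc)
    then show ?case by blast
  qed (auto simp: main_aut_one)
  with assms obtain y where "main_aut s * vec_cl x = vec_cl y * s" unfolding Pin_def by blast
  then have y: "vec_cl y = main_aut s * vec_cl x * cl_inv s"
    using Pin_invertible[OF assms] by (simp add: mult.assoc)
  show ?thesis
    unfolding pin_cover_def using y by (rule theI[where a = y]) (metis y inj_vec_cl injD)
qed

definition pin_sgn :: "'m::{finite,linorder} clifford \<Rightarrow> real" where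
  "pin_sgn s = det (matrix (pin_cover s))"

section \<open>Root systems and reflection groups\<close>

definition refl_root :: "real ^ 'm \<Rightarrow> real ^ 'm \<Rightarrow> real ^ 'm::finite" where
  "refl_root \<alpha> x = x - (2 * (\<alpha> \<bullet> x) / (norm \<alpha>)\<^sup>2) *\<^sub>R \<alpha>"

text \<open>As usual for Dunkl operators, neither crystallographic nor required to span the space.\<close>

definition reduced_root_system :: "(real ^ 'm::finite) set \<Rightarrow> bool" where
  "reduced_root_system R \<longleftrightarrow> finite R \<and> 0 \<notin> R
    \<and> (\<forall>\<alpha>\<in>R. refl_root \<alpha> ` R = R)
    \<and> (\<forall>\<alpha>\<in>R. R \<inter> range (\<lambda>t. t *\<^sub>R \<alpha>) = {\<alpha>, - \<alpha>})"

definition positive_subsystem :: "(real ^ 'm::finite) set \<Rightarrow> (real ^ 'm) set \<Rightarrow> bool" where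
  "positive_subsystem R Rp \<longleftrightarrow>
    (\<exists>\<beta>. (\<forall>\<alpha>\<in>R. \<alpha> \<bullet> \<beta> \<noteq> 0) \<and> Rp = {\<alpha> \<in> R. \<alpha> \<bullet> \<beta> > 0})"

definition reflection_group :: "(real ^ 'm::finite) set \<Rightarrow> (real ^ 'm \<Rightarrow> real ^ 'm) set" where
  "reflection_group R = generate (BijGroup UNIV) (refl_root ` R)"

definition pin_reflection_group :: "(real, 'm::{finite,linorder}) vec set \<Rightarrow> 'm clifford set" where
  "pin_reflection_group R = {s \<in> Pin. pin_cover s \<in> reflection_group R}"

text \<open>Only the values of \<open>\<kappa>\<close> on \<open>R\<close> are relevant.\<close>

definition multiplicity_function :: "(real ^ 'm::finite) set \<Rightarrow> (real ^ 'm \<Rightarrow> real) \<Rightarrow> bool" where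
  "multiplicity_function R \<kappa> \<longleftrightarrow>
    (\<forall>\<alpha>\<in>R. 0 \<le> \<kappa> \<alpha>) \<and> (\<forall>g\<in>reflection_group R. \<forall>\<alpha>\<in>R. \<kappa> (g \<alpha>) = \<kappa> \<alpha>)"

section \<open>The operators\<close>

fun C_k :: "nat \<Rightarrow> ('a::real_normed_vector \<Rightarrow> 'b::real_normed_vector) \<Rightarrow> bool" where
  "C_k 0 f \<longleftrightarrow> continuous_on UNIV f"
| "C_k (Suc k) f \<longleftrightarrow> f differentiable_on UNIV
    \<and> (\<forall>v. C_k k (\<lambda>x. frechet_derivative f (at x) v))"

definition smooth :: "('a::real_normed_vector \<Rightarrow> 'b::real_normed_vector) \<Rightarrow> bool" where
  "smooth f \<longleftrightarrow> (\<forall>k. C_k k f)"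

definition partial :: "'m \<Rightarrow> (real ^ 'm::finite \<Rightarrow> 'b::real_normed_vector) \<Rightarrow> real ^ 'm \<Rightarrow> 'b" where
  "partial i f x = vector_derivative (\<lambda>t. f (x + t *\<^sub>R axis i 1)) (at 0)"

text \<open>
  The difference quotient in the Dunkl operators has a removable singularity along the hyperplane
  orthogonal to \<open>\<alpha>\<close>; there it denotes its continuous extension.
\<close>

definition dunkl_quotient ::
    "real ^ 'm \<Rightarrow> (real ^ 'm::finite \<Rightarrow> 'b::real_normed_vector) \<Rightarrow> real ^ 'm \<Rightarrow> 'b" where
  "dunkl_quotient \<alpha> f x =
    (if \<alpha> \<bullet> x \<noteq> 0 then (f x - f (refl_root \<alpha> x)) /\<^sub>R (\<alpha> \<bullet> x)
     else Lim (at x within {y. \<alpha> \<bullet> y \<noteq> 0}) (\<lambda>y. (f y - f (refl_root \<alpha> y)) /\<^sub>R (\<alpha> \<bullet> y)))"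

definition dunkl ::
    "(real ^ 'm) set \<Rightarrow> (real ^ 'm \<Rightarrow> real) \<Rightarrow> 'm \<Rightarrow>
      (real ^ 'm::finite \<Rightarrow> 'b::real_normed_vector) \<Rightarrow> real ^ 'm \<Rightarrow> 'b" where
  "dunkl Rp \<kappa> i f x =
    partial i f x + (\<Sum>\<alpha>\<in>Rp. (\<kappa> \<alpha> * \<alpha> $ i) *\<^sub>R dunkl_quotient \<alpha> f x)"

definition euler :: "(real ^ 'm::finite \<Rightarrow> 'b::real_normed_vector) \<Rightarrow> real ^ 'm \<Rightarrow> 'b" where
  "euler f x = (\<Sum>i\<in>UNIV. (x $ i) *\<^sub>R partial i f x)"

definition vec_mult ::
    "((real, 'm::{finite,linorder}) vec \<Rightarrow> 'm clifford) \<Rightarrow> (real, 'm) vec \<Rightarrow> 'm clifford" where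
  "vec_mult f x = vec_cl x * f x"

definition dunkl_dirac ::
    "(real, 'm::{finite,linorder}) vec set \<Rightarrow> ((real, 'm) vec \<Rightarrow> real) \<Rightarrow>
      ((real, 'm) vec \<Rightarrow> 'm clifford) \<Rightarrow> (real, 'm) vec \<Rightarrow> 'm clifford" where
  "dunkl_dirac Rp \<kappa> f x = (\<Sum>i\<in>UNIV. gen i * dunkl Rp \<kappa> i f x)"

text \<open>Meaningful for \<open>x \<noteq> 0\<close> only.\<close>

definition deformed_dirac ::
    "(real, 'm::{finite,linorder}) vec set \<Rightarrow> ((real, 'm) vec \<Rightarrow> real) \<Rightarrow> real \<Rightarrow>
      ((real, 'm) vec \<Rightarrow> 'm clifford) \<Rightarrow> (real, 'm) vec \<Rightarrow> 'm clifford" where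
  "deformed_dirac Rp \<kappa> c f x =
    dunkl_dirac Rp \<kappa> f x + (c / (norm x)\<^sup>2) *\<^sub>R vec_mult (euler f) x"

text \<open>
  \<open>C\<^sup>\<infinity>(\<real>\<^sup>m) \<otimes> Cl\<^sub>m\<close> is identified with the smooth Clifford-valued functions,
  \<open>f \<otimes> b\<close> being the function \<open>x \<mapsto> f(x) b\<close>.
\<close>

definition pin_action ::
    "'m::{finite,linorder} clifford \<Rightarrow> ((real, 'm) vec \<Rightarrow> 'm clifford) \<Rightarrow> (real, 'm) vec \<Rightarrow> 'm clifford" where
  "pin_action s F x = s * F (pin_cover (cl_inv s) x)"

lemma pin_action_tensor:
  "pin_action s (\<lambda>x. f x *\<^sub>R b) = (\<lambda>x. f (pin_cover (cl_inv s) x) *\<^sub>R (s * b))"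
  by (simp add: pin_action_def fun_eq_iff)

lemma pin_action_add:
  "pin_action s (\<lambda>x. F x + G x) = (\<lambda>x. pin_action s F x + pin_action s G x)"
  by (simp add: pin_action_def fun_eq_iff algebra_simps)

end

theory Submission
  imports Defs
begin

text \<open>
  On \<open>Pin\<close> the main automorphism is multiplication by the sign of the covering isometry, so
  \<open>g = p(s)\<close> satisfies \<open>vec_cl (g x) s = sgn(s) s vec_cl x\<close>; this is the first identity.
  Since \<open>g\<close> is orthogonal, the vector derivative and the Euler operator transform accordingly.
  For the difference part, the summand of \<open>\<alpha>\<close> in the Dunkl operator is even in \<open>\<alpha>\<close>, so the sum
  over positive roots is half the sum over \<open>R\<close>, which \<open>g\<close> permutes without changing \<open>\<kappa>\<close>. On the
  reflecting hyperplanes the difference quotient is a directional derivative, so there the limit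
  exists and transforms like the quotient.
\<close>

section \<open>The covering of the orthogonal group\<close>

lemma one_in_Pin: "1 \<in> Pin"
  unfolding Pin_def by (auto intro: exI[of _ "[]"])

lemma Pin_times:
  assumes "s \<in> Pin" "t \<in> Pin"
  shows "s * t \<in> Pin"
proof -
  obtain ss ts where "s = prod_list ss" "\<forall>v\<in>set ss. v \<in> range vec_cl \<and> v * v = - 1"
    "t = prod_list ts" "\<forall>v\<in>set ts. v \<in> range vec_cl \<and> v * v = - 1"
    using assms unfolding Pin_def by blast
  then show ?thesis
    unfolding Pin_def by (auto intro!: exI[of _ "ss @ ts"])
qed

lemma unit_vector_in_Pin:
  assumes "vec_cl a * vec_cl a = - 1"
  shows "vec_cl a \<in> Pin"
  unfolding Pin_def using assms by (auto intro!: exI[of _ "[vec_cl a]"])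

text \<open>Lets multiplicative facts about \<open>Pin\<close> be checked on unit vectors alone;
  closure under inverses and the comparison of the main automorphism with the determinant sign
  follow this way.\<close>

lemma Pin_induct [consumes 1, case_names one vec]:
  assumes "s \<in> Pin"
    and "P 1"
    and "\<And>a t. vec_cl a * vec_cl a = - 1 \<Longrightarrow> t \<in> Pin \<Longrightarrow> P t \<Longrightarrow> P (vec_cl a * t)"
  shows "P s"
proof -
  obtain ss where s: "s = prod_list ss" and ss: "\<forall>v\<in>set ss. v \<in> range vec_cl \<and> v * v = - 1"
    using assms(1) unfolding Pin_def by blast
  \<comment> \<open>Membership in \<open>Pin\<close> is carried along because the vector case asks
    for it of the remaining factor.\<close>
  from ss have "prod_list ss \<in> Pin \<and> P (prod_list ss)"
  proof (induction ss)
    case Nil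
    show ?case using one_in_Pin assms(2) by simp
  next
    case (Cons v ss)
    then obtain a where "v = vec_cl a" "vec_cl a * vec_cl a = - 1" by auto
    with Cons show ?case by (simp add: Pin_times unit_vector_in_Pin assms(3))
  qed
  with s show ?thesis by simp
qed

lemma cl_inv_one: "cl_inv 1 = 1"
  by (rule cl_inv_eqI) simp_all

lemma cl_inv_times:
  assumes "s \<in> Pin" "t \<in> Pin"
  shows "cl_inv (s * t) = cl_inv t * cl_inv s"
proof (rule cl_inv_eqI)
  have "s * t * (cl_inv t * cl_inv s) = s * (t * cl_inv t) * cl_inv s"
    by (simp add: mult.assoc)
  then show "s * t * (cl_inv t * cl_inv s) = 1"
    using assms by (simp add: Pin_invertible)
  have "cl_inv t * cl_inv s * (s * t) = cl_inv t * (cl_inv s * s) * t"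
    by (simp add: mult.assoc)
  then show "cl_inv t * cl_inv s * (s * t) = 1"
    using assms by (simp add: Pin_invertible)
qed

lemma cl_inv_cl_inv: "s \<in> Pin \<Longrightarrow> cl_inv (cl_inv s) = s"
  by (rule cl_inv_eqI) (simp_all add: Pin_invertible)

lemma cl_inv_unit_vector:
  assumes "vec_cl a * vec_cl a = - 1"
  shows "cl_inv (vec_cl a) = vec_cl (- a)"
  by (rule cl_inv_eqI) (simp_all add: linear_neg[OF linear_vec_cl] assms)

lemma cl_inv_in_Pin:
  assumes "s \<in> Pin"
  shows "cl_inv s \<in> Pin"
  using assms
proof (induction rule: Pin_induct)
  case one
  show ?case by (simp add: cl_inv_one one_in_Pin)
next
  case (vec a t)
  have "vec_cl (- a) * vec_cl (- a) = - 1"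
    using vec by (simp add: linear_neg[OF linear_vec_cl])
  with vec show ?case
    by (simp add: cl_inv_times unit_vector_in_Pin cl_inv_unit_vector Pin_times)
qed

text \<open>\<open>pin_cover\<close> is a definite description; injectivity of \<open>vec_cl\<close>
  reduces every identity for it to an identity in the Clifford algebra.\<close>

lemma pin_cover_eqI:
  assumes "s \<in> Pin" "vec_cl y = main_aut s * vec_cl x * cl_inv s"
  shows "pin_cover s x = y"
  using vec_cl_pin_cover[OF assms(1)] assms(2) by (metis inj_vec_cl injD)

lemma pin_cover_one: "pin_cover 1 = id"
  by (rule ext) (simp add: pin_cover_eqI one_in_Pin main_aut_one cl_inv_one)

lemma pin_cover_times:
  assumes "s \<in> Pin" "t \<in> Pin"
  shows "pin_cover (s * t) = pin_cover s \<circ> pin_cover t"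
proof
  fix x
  show "pin_cover (s * t) x = (pin_cover s \<circ> pin_cover t) x"
    by (rule pin_cover_eqI)
      (simp_all add: Pin_times assms vec_cl_pin_cover main_aut_times cl_inv_times mult.assoc)
qed

lemma linear_pin_cover:
  assumes "s \<in> Pin"
  shows "linear (pin_cover s)"
proof (rule linearI)
  show "pin_cover s (x + y) = pin_cover s x + pin_cover s y" for x y
    by (rule pin_cover_eqI)
      (simp_all add: assms linear_add[OF linear_vec_cl] vec_cl_pin_cover algebra_simps)
  show "pin_cover s (r *\<^sub>R x) = r *\<^sub>R pin_cover s x" for r x
    by (rule pin_cover_eqI)
      (simp_all add: assms linear_scale[OF linear_vec_cl] vec_cl_pin_cover)
qed

lemma pin_cover_cl_inv:
  assumes "s \<in> Pin"
  shows "pin_cover s (pin_cover (cl_inv s) x) = x" "pin_cover (cl_inv s) (pin_cover s x) = x"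
  using pin_cover_times[OF assms cl_inv_in_Pin[OF assms]]
    pin_cover_times[OF cl_inv_in_Pin[OF assms] assms]
  by (simp_all add: Pin_invertible assms pin_cover_one fun_eq_iff)

text \<open>The anticommutator of \<open>vec_cl a\<close> with itself is twice its square.\<close>

lemma unit_vector_inner:
  assumes "vec_cl a * vec_cl a = - 1"
  shows "a \<bullet> a = 1"
proof -
  have "(- 2 * (a \<bullet> a)) *\<^sub>R (1 :: 'a clifford) = (- 2) *\<^sub>R 1"
    using vec_cl_anticommutator[of a a] assms by (simp flip: scaleR_2)
  then show ?thesis
    by (metis mult_cancel_left mult.right_neutral neg_equal_0_iff_equal one_neq_zero
        scaleR_cancel_right zero_neq_numeral)
qed

section \<open>Euclidean reflections and their determinants\<close>

lemma linear_refl_root: "linear (refl_root \<alpha>)"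
  by (rule linearI) (simp_all add: refl_root_def inner_add_right algebra_simps add_divide_distrib)

lemma norm_refl_root: "norm (refl_root \<alpha> x) = norm x"
proof (cases "\<alpha> = 0")
  case False
  define c where "c = 2 * (\<alpha> \<bullet> x) / (norm \<alpha>)\<^sup>2"
  \<comment> \<open>By this choice of \<open>c\<close>, the quadratic term in the expanded square
    cancels the cross term.\<close>
  have "c * (norm \<alpha>)\<^sup>2 = 2 * (\<alpha> \<bullet> x)" using False by (simp add: c_def)
  moreover have "(norm (x - c *\<^sub>R \<alpha>))\<^sup>2 = (norm x)\<^sup>2 - 2 * c * (\<alpha> \<bullet> x) + c * (c * (norm \<alpha>)\<^sup>2)"
    by (simp add: power2_norm_eq_inner inner_diff_left inner_diff_right inner_commute[of x \<alpha>]
        right_diff_distrib)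
  ultimately have "(norm (x - c *\<^sub>R \<alpha>))\<^sup>2 = (norm x)\<^sup>2" by simp
  then have "(norm (refl_root \<alpha> x))\<^sup>2 = (norm x)\<^sup>2" by (simp add: refl_root_def c_def)
  then show ?thesis by simp
qed (simp add: refl_root_def)

text \<open>
  An orthogonal transformation taking the root to a coordinate axis conjugates the reflection
  to a diagonal one.
\<close>

lemma det_refl_root:
  fixes \<alpha> :: "real ^ 'm::finite"
  assumes "\<alpha> \<noteq> 0"
  shows "det (matrix (refl_root \<alpha>)) = - 1"
proof -
  obtain k :: 'm where True by blast
  define \<beta> :: "real ^ 'm" where "\<beta> = norm \<alpha> *\<^sub>R axis k 1"
  have "norm \<alpha> = norm \<beta>"  by (simp add: \<beta>_def)
  then obtain f where f: "orthogonal_transformation f" "f \<alpha> = \<beta>"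
    by (rule orthogonal_transformation_exists)
  have lin: "linear f" and norm_f: "norm (f x) = norm x" and inner_f: "f x \<bullet> f y = x \<bullet> y" for x y
    using f(1) by (auto simp: orthogonal_transformation_def norm_eq_sqrt_inner)
  \<comment> \<open>An isometry carries the reflection in a vector to the reflection in its image;
    taking determinants, the nonzero factor \<open>det (matrix f)\<close> cancels.\<close>
  have "refl_root \<beta> \<circ> f = f \<circ> refl_root \<alpha>"
    by (rule ext) (simp add: refl_root_def linear_diff[OF lin] linear_scale[OF lin] norm_f inner_f
        flip: f(2))
  then have "matrix (refl_root \<beta>) ** matrix f = matrix f ** matrix (refl_root \<alpha>)"
    using lin by (metis linear_refl_root matrix_compose)
  then have "det (matrix (refl_root \<beta>)) * det (matrix f) = det (matrix f) * det (matrix (refl_root \<alpha>))"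
    by (metis det_mul)
  moreover have "det (matrix f) \<noteq> 0"
    using f(1) det_orthogonal_matrix[of "matrix f"] by (auto simp: orthogonal_transformation_matrix)
  ultimately have "det (matrix (refl_root \<alpha>)) = det (matrix (refl_root \<beta>))" by simp
  also have "\<dots> = (\<Prod>i\<in>UNIV. if i = k then - 1 else 1)"
  proof -
    have refl_\<beta>: "refl_root \<beta> x = x - (2 * x $ k) *\<^sub>R axis k 1" for x
      using assms by (simp add: refl_root_def \<beta>_def inner_axis' power2_eq_square)
    have entry: "matrix (refl_root \<beta>) $ i $ j = (if i = j then if i = k then - 1 else 1 else 0)" for i j
      by (auto simp: matrix_def refl_\<beta> axis_def)
    have "det (matrix (refl_root \<beta>)) = (\<Prod>i\<in>UNIV. matrix (refl_root \<beta>) $ i $ i)"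
      by (rule det_diagonal) (simp add: entry)
    then show ?thesis by (simp add: entry)
  qed
  finally show ?thesis by simp
qed

text \<open>The main automorphism and the inverse each turn \<open>a\<close> into
  \<open>- a\<close>, so the two signs cancel and the covering sends x to the product a x a, which
  the anticommutator evaluates.\<close>

lemma pin_cover_unit_vector:
  assumes "vec_cl a * vec_cl a = - 1"
  shows "pin_cover (vec_cl a) = refl_root a"
proof
  fix x
  have "vec_cl a * vec_cl x = (- 2 * (a \<bullet> x)) *\<^sub>R 1 - vec_cl x * vec_cl a"
    using vec_cl_anticommutator[of a x] by (simp add: algebra_simps)
  then have "vec_cl a * vec_cl x * vec_cl a = (- 2 * (a \<bullet> x)) *\<^sub>R vec_cl a + vec_cl x"
    by (simp add: left_diff_distrib mult.assoc assms)
  then show "pin_cover (vec_cl a) x = refl_root a x"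
    using unit_vector_inner[OF assms]
    by (intro pin_cover_eqI)
      (simp_all add: unit_vector_in_Pin assms cl_inv_unit_vector main_aut_vec_cl refl_root_def power2_norm_eq_inner
        linear_neg[OF linear_vec_cl] linear_diff[OF linear_vec_cl] linear_scale[OF linear_vec_cl]
        inner_commute)
qed

section \<open>The sign character and the isometry property\<close>

lemma pin_sgn_one: "pin_sgn 1 = 1"
  by (simp add: pin_sgn_def pin_cover_one matrix_id_mat_1)

lemma pin_sgn_times:
  assumes "s \<in> Pin" "t \<in> Pin"
  shows "pin_sgn (s * t) = pin_sgn s * pin_sgn t"
  by (simp add: pin_sgn_def pin_cover_times assms matrix_compose linear_pin_cover det_mul)

lemma pin_sgn_unit_vector:
  assumes "vec_cl a * vec_cl a = - 1"
  shows "pin_sgn (vec_cl a) = - 1"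
proof -
  have "a \<noteq> 0" using unit_vector_inner[OF assms] by auto
  then show ?thesis
    by (simp add: pin_sgn_def pin_cover_unit_vector assms det_refl_root)
qed

lemma pin_sgn_square: "s \<in> Pin \<Longrightarrow> pin_sgn s * pin_sgn s = 1"
  by (induction rule: Pin_induct)
    (simp_all add: pin_sgn_one pin_sgn_times unit_vector_in_Pin pin_sgn_unit_vector)

text \<open>Both the main automorphism and the determinant sign are multiplicative, and each
  contributes -1 for a unit vector: the sign is the parity of the number of factors.\<close>

lemma main_aut_Pin: "s \<in> Pin \<Longrightarrow> main_aut s = pin_sgn s *\<^sub>R s"
  by (induction rule: Pin_induct)
    (simp_all add: main_aut_one pin_sgn_one main_aut_times main_aut_vec_cl pin_sgn_times
      unit_vector_in_Pin pin_sgn_unit_vector)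

text \<open>The form in which the covering enters all later computations: moving a vector past
  \<open>s\<close> costs exactly the sign, and no inverse of \<open>s\<close> remains.\<close>

lemma vec_cl_pin_cover_times:
  assumes "s \<in> Pin"
  shows "vec_cl (pin_cover s x) * s = pin_sgn s *\<^sub>R (s * vec_cl x)"
  by (simp add: vec_cl_pin_cover main_aut_Pin assms mult.assoc Pin_invertible)

text \<open>On products of two vectors the signs square to one, so the covering acts as conjugation
  by \<open>s\<close>. Conjugation fixes scalars, and the inner product is a scalar multiple of the
  anticommutator.\<close>

lemma pin_cover_inner:
  assumes "s \<in> Pin"
  shows "pin_cover s x \<bullet> pin_cover s y = x \<bullet> y"
proof -
  have *: "vec_cl (pin_cover s x) * vec_cl (pin_cover s y) = s * (vec_cl x * vec_cl y) * cl_inv s"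
    for x y
  proof -
    have "vec_cl (pin_cover s x) * vec_cl (pin_cover s y)
        = (pin_sgn s * pin_sgn s) *\<^sub>R (s * vec_cl x * (cl_inv s * s) * vec_cl y * cl_inv s)"
      by (simp add: vec_cl_pin_cover main_aut_Pin assms mult.assoc)
    then show ?thesis
      by (simp add: pin_sgn_square assms Pin_invertible mult.assoc)
  qed
  have "(- 2 * (pin_cover s x \<bullet> pin_cover s y)) *\<^sub>R (1 :: 'a clifford)
      = s * (vec_cl x * vec_cl y + vec_cl y * vec_cl x) * cl_inv s"
    unfolding vec_cl_anticommutator[symmetric] * by (simp add: algebra_simps)
  also have "\<dots> = (- 2 * (x \<bullet> y)) *\<^sub>R 1"
    unfolding vec_cl_anticommutator by (simp add: Pin_invertible assms)
  finally show ?thesis by simp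
qed

lemma pin_cover_adjoint:
  assumes "s \<in> Pin"
  shows "pin_cover (cl_inv s) x \<bullet> y = x \<bullet> pin_cover s y"
  by (metis assms pin_cover_inner pin_cover_cl_inv(1))

lemma norm_pin_cover: "s \<in> Pin \<Longrightarrow> norm (pin_cover s x) = norm x"
  by (simp add: norm_eq_sqrt_inner pin_cover_inner)

lemma pin_cover_refl_root:
  assumes "s \<in> Pin"
  shows "pin_cover s (refl_root \<alpha> x) = refl_root (pin_cover s \<alpha>) (pin_cover s x)"
  by (simp add: refl_root_def linear_diff[OF linear_pin_cover] linear_scale[OF linear_pin_cover]
      assms pin_cover_inner norm_pin_cover)

section \<open>Root systems\<close>

text \<open>The reflections generating the group permute \<open>R\<close>, and this property passes
  to inverses and compositions.\<close>

lemma reflection_group_image: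
  assumes "reduced_root_system R" "g \<in> reflection_group R"
  shows "g ` R = R"
proof -
  have refl: "refl_root \<alpha> ` R = R" "refl_root \<alpha> \<in> Bij UNIV" if "\<alpha> \<in> R" for \<alpha>
  proof -
    show "refl_root \<alpha> ` R = R" using assms(1) that by (simp add: reduced_root_system_def)
    have "\<alpha> \<noteq> 0" using assms(1) that by (auto simp: reduced_root_system_def)
    then have "refl_root \<alpha> (refl_root \<alpha> x) = x" for x
      by (simp add: refl_root_def inner_diff_right power2_norm_eq_inner)
    then show "refl_root \<alpha> \<in> Bij UNIV"
      by (auto simp: Bij_def intro!: o_bij[of "refl_root \<alpha>"])
  qed
  \<comment> \<open>Bijectivity is part of the induction because inversion and multiplication in
    \<open>BijGroup\<close> agree with those of functions only on its carrier.\<close>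
  have "g \<in> Bij UNIV \<and> g ` R = R"
    using assms(2) unfolding reflection_group_def
  proof (induction rule: generate.induct)
    case one
    show ?case by (auto simp: BijGroup_def Bij_def bij_betw_def)
  next
    case (incl h)
    then show ?case using refl by auto
  next
    case (inv h)
    then obtain \<alpha> where h: "h = refl_root \<alpha>" "\<alpha> \<in> R" by auto
    then have "inv_into UNIV h ` R = R"
      using refl[of \<alpha>] by (metis Bij_def IntD2 mem_Collect_eq bij_is_inj image_inv_f_f)
    moreover have "inv_into UNIV h \<in> Bij UNIV"
      using restrict_inv_into_Bij[of h UNIV] refl(2) h by (simp add: restrict_UNIV)
    ultimately show ?case
      using h refl[of \<alpha>] by (simp add: inv_BijGroup)
  next
    case (eng h1 h2)
    have "compose UNIV h1 h2 ` R = h1 ` h2 ` R"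
      by (simp add: compose_def restrict_UNIV image_image)
    with eng.IH show ?case by (simp add: BijGroup_def compose_Bij)
  qed
  then show ?thesis ..
qed

lemma uminus_root: "reduced_root_system R \<Longrightarrow> \<alpha> \<in> R \<Longrightarrow> - \<alpha> \<in> R"
  unfolding reduced_root_system_def by blast

text \<open>A covering transformation may move positive roots to negative ones. Passing to the sum
  over \<open>R\<close> makes reindexing possible, as \<open>R\<close> is the disjoint union of
  \<open>Rp\<close> and its negatives.\<close>

lemma sum_positive_subsystem:
  fixes h :: "real ^ 'm::finite \<Rightarrow> 'b::real_vector"
  assumes R: "reduced_root_system R" and Rp: "positive_subsystem R Rp"
    and even: "\<And>\<alpha>. \<alpha> \<in> R \<Longrightarrow> h (- \<alpha>) = h \<alpha>"
  shows "(\<Sum>\<alpha>\<in>R. h \<alpha>) = 2 *\<^sub>R (\<Sum>\<alpha>\<in>Rp. h \<alpha>)"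
proof -
  obtain \<beta> where \<beta>: "\<forall>\<alpha>\<in>R. \<alpha> \<bullet> \<beta> \<noteq> 0" "Rp = {\<alpha> \<in> R. \<alpha> \<bullet> \<beta> > 0}"
    using Rp unfolding positive_subsystem_def by blast
  note neg = uminus_root[OF R]
  have "finite R" using R unfolding reduced_root_system_def by blast
  have "R = Rp \<union> uminus ` Rp"
  proof
    show "R \<subseteq> Rp \<union> uminus ` Rp"
    proof
      fix \<alpha> assume "\<alpha> \<in> R"
      then have "\<alpha> \<in> Rp \<or> - \<alpha> \<in> Rp" using \<beta> neg[of \<alpha>] by (auto simp: not_less order.order_iff_strict)
      then show "\<alpha> \<in> Rp \<union> uminus ` Rp" by (metis UnI1 UnI2 image_eqI minus_minus)
    qed
    show "Rp \<union> uminus ` Rp \<subseteq> R" using \<beta>(2) neg by auto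
  qed
  moreover have "Rp \<inter> uminus ` Rp = {}" using \<beta>(2) by auto
  moreover have "finite Rp" using \<beta>(2) \<open>finite R\<close> by simp
  ultimately have "sum h R = sum h Rp + sum h (uminus ` Rp)"
    by (metis sum.union_disjoint finite_imageI)
  also have "sum h (uminus ` Rp) = (\<Sum>\<alpha>\<in>Rp. h (- \<alpha>))"
    by (subst sum.reindex) (auto simp: inj_on_def)
  also have "\<dots> = sum h Rp" by (rule sum.cong) (use even \<beta>(2) in auto)
  finally show ?thesis by (simp add: scaleR_2)
qed

text \<open>A root and its negative lie in one orbit, since the reflection in a root negates
  it.\<close>

lemma multiplicity_function_uminus:
  assumes "reduced_root_system R" "multiplicity_function R \<kappa>" "\<alpha> \<in> R"
  shows "\<kappa> (- \<alpha>) = \<kappa> \<alpha>"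
proof -
  have "\<alpha> \<noteq> 0" using assms(1,3) by (auto simp: reduced_root_system_def)
  then have "refl_root \<alpha> \<alpha> = - \<alpha>"
    by (simp add: refl_root_def power2_norm_eq_inner scaleR_2)
  moreover have "refl_root \<alpha> \<in> reflection_group R"
    unfolding reflection_group_def using assms(3) by (auto intro: generate.incl)
  ultimately show ?thesis
    using assms(2,3) unfolding multiplicity_function_def by metis
qed

section \<open>Dunkl operators on continuously differentiable functions\<close>

lemma partial_eq:
  assumes "(f has_derivative D) (at x)"
  shows "partial i f x = D (axis i 1)"
proof -
  interpret D: bounded_linear D by (rule has_derivative_bounded_linear[OF assms])
  have "((\<lambda>t. x + t *\<^sub>R axis i 1) has_derivative (\<lambda>t. t *\<^sub>R axis i 1)) (at 0)"
    by (auto intro!: derivative_eq_intros)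
  moreover have "(f has_derivative D) (at (x + 0 *\<^sub>R axis i 1))" using assms by simp
  ultimately have "((\<lambda>t. f (x + t *\<^sub>R axis i 1)) has_derivative (\<lambda>t. D (t *\<^sub>R axis i 1))) (at 0)"
    by (rule has_derivative_compose)
  then show ?thesis
    unfolding partial_def
    by (intro vector_derivative_at) (simp add: has_vector_derivative_def D.scaleR)
qed

text \<open>Writing the Euler operator as the derivative in the direction of the point itself
  removes the basis, so its invariance becomes the chain rule.\<close>

lemma euler_eq:
  assumes "(f has_derivative D) (at x)"
  shows "euler f x = D x"
proof -
  interpret D: bounded_linear D by (rule has_derivative_bounded_linear[OF assms])
  have "D x = D (\<Sum>i\<in>UNIV. (x $ i) *\<^sub>R axis i 1)"
    by (simp add: basis_expansion flip: scalar_mult_eq_scaleR)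
  then show ?thesis
    by (simp add: euler_def partial_eq[OF assms] D.sum D.scaleR)
qed

text \<open>The numerator is the increment of \<open>f\<close> over a segment parallel to
  \<open>\<alpha>\<close> whose length is proportional to the denominator. The mean value inequality
  and continuity of the derivative give the limit.\<close>

lemma dunkl_quotient_hyperplane:
  fixes f :: "real ^ 'm::finite \<Rightarrow> 'b::real_normed_vector"
  assumes f: "\<And>y. (f has_derivative D y) (at y)"
    and cont: "continuous_on UNIV (\<lambda>y. D y \<alpha>)"
    and "\<alpha> \<noteq> 0" "\<alpha> \<bullet> x = 0"
  shows "dunkl_quotient \<alpha> f x = (2 / (norm \<alpha>)\<^sup>2) *\<^sub>R D x \<alpha>"
proof -
  define k where "k = 2 / (norm \<alpha>)\<^sup>2"
  define S where "S = {y. \<alpha> \<bullet> y \<noteq> 0}"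
  have "k > 0" using \<open>\<alpha> \<noteq> 0\<close> by (simp add: k_def)
  have refl: "refl_root \<alpha> y = y - (k * (\<alpha> \<bullet> y)) *\<^sub>R \<alpha>" for y
    by (simp add: refl_root_def k_def)
  have "((\<lambda>y. (f y - f (refl_root \<alpha> y)) /\<^sub>R (\<alpha> \<bullet> y)) \<longlongrightarrow> k *\<^sub>R D x \<alpha>) (at x within S)"
    unfolding tendsto_iff
  proof (intro allI impI)
    fix e :: real assume "e > 0"
    \<comment> \<open>The final estimate is \<open>k * \<epsilon>\<close>, which is
      \<open>e / 2\<close> and hence strictly below \<open>e\<close>.\<close>
    define \<epsilon> where "\<epsilon> = e / (2 * k)"
    have "\<epsilon> > 0" using \<open>e > 0\<close> \<open>k > 0\<close> by (simp add: \<epsilon>_def)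
    then obtain \<delta> where "\<delta> > 0" and \<delta>: "\<And>y. dist y x < \<delta> \<Longrightarrow> norm (D y \<alpha> - D x \<alpha>) < \<epsilon>"
      using cont unfolding continuous_on_iff dist_norm by (metis UNIV_I)
    have "dist ((f y - f (refl_root \<alpha> y)) /\<^sub>R (\<alpha> \<bullet> y)) (k *\<^sub>R D x \<alpha>) < e"
      if "y \<in> S" "dist y x < \<delta>" for y
    proof -
      define t where "t = k * (\<alpha> \<bullet> y)"
      \<comment> \<open>Follows the segment from \<open>y\<close> to its mirror image and removes
        the expected linear change, so \<open>\<psi> 1 - \<psi> 0\<close> is the error to bound and
        the derivative of \<open>\<psi>\<close> contains only differences of
        \<open>D\<close>.\<close>
      define \<psi> where "\<psi> u = f (y - (u * t) *\<^sub>R \<alpha>) + (u * t) *\<^sub>R D x \<alpha>" for u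
      \<comment> \<open>The reflection fixes \<open>x\<close>, so the mirror image of
        \<open>y\<close> is as close to \<open>x\<close> as \<open>y\<close> is; convexity of the
        ball then controls the whole segment.\<close>
      have "refl_root \<alpha> y - x = refl_root \<alpha> (y - x)"
        using \<open>\<alpha> \<bullet> x = 0\<close> by (simp add: linear_diff[OF linear_refl_root]) (simp add: refl)
      then have "dist (refl_root \<alpha> y) x < \<delta>" using that by (simp add: dist_norm norm_refl_root)
      have near: "norm (D (y - (u * t) *\<^sub>R \<alpha>) \<alpha> - D x \<alpha>) < \<epsilon>" if "u \<in> {0..1}" for u
      proof (rule \<delta>)
        have "(1 - u) *\<^sub>R y + u *\<^sub>R refl_root \<alpha> y \<in> ball x \<delta>"
          using that \<open>dist y x < \<delta>\<close> \<open>dist (refl_root \<alpha> y) x < \<delta>\<close>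
          by (intro convexD[OF convex_ball]) (auto simp: dist_commute)
        moreover have "(1 - u) *\<^sub>R y + u *\<^sub>R refl_root \<alpha> y = y - (u * t) *\<^sub>R \<alpha>"
          by (simp add: refl t_def algebra_simps)
        ultimately show "dist (y - (u * t) *\<^sub>R \<alpha>) x < \<delta>" by (simp add: dist_commute)
      qed
      have deriv: "(\<psi> has_derivative (\<lambda>h. (h * - t) *\<^sub>R (D (y - (u * t) *\<^sub>R \<alpha>) \<alpha> - D x \<alpha>)))
          (at u within {0..1})" for u
      proof -
        interpret D: bounded_linear "D (y - (u * t) *\<^sub>R \<alpha>)"
          by (rule has_derivative_bounded_linear[OF f])
        have "((\<lambda>u. y - (u * t) *\<^sub>R \<alpha>) has_derivative (\<lambda>h. (h * - t) *\<^sub>R \<alpha>)) (at u within {0..1})"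
          by (auto intro!: derivative_eq_intros)
        then have "((\<lambda>u. f (y - (u * t) *\<^sub>R \<alpha>)) has_derivative
            (\<lambda>h. D (y - (u * t) *\<^sub>R \<alpha>) ((h * - t) *\<^sub>R \<alpha>))) (at u within {0..1})"
          by (rule has_derivative_compose) (rule f)
        then show ?thesis
          unfolding \<psi>_def
          by (auto intro!: derivative_eq_intros simp: D.scaleR D.neg scaleR_right_diff_distrib)
      qed
      have "norm (\<psi> 1 - \<psi> 0) \<le> (\<bar>t\<bar> * \<epsilon>) * norm (1 - 0 :: real)"
      proof (rule differentiable_bound[OF convex_real_interval(5) deriv])
        fix u :: real assume "u \<in> {0..1}"
        from near[OF this] show "onorm (\<lambda>h. (h * - t) *\<^sub>R (D (y - (u * t) *\<^sub>R \<alpha>) \<alpha> - D x \<alpha>)) \<le> \<bar>t\<bar> * \<epsilon>"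
          by (intro onorm_le) (simp add: abs_mult mult.assoc mult.left_commute[of _ "\<bar>t\<bar>"]
              mult_left_mono mult.commute[of \<epsilon>] less_imp_le)
      qed auto
      then have bound: "norm (f (refl_root \<alpha> y) + t *\<^sub>R D x \<alpha> - f y) \<le> \<bar>t\<bar> * \<epsilon>"
        by (simp add: \<psi>_def refl t_def)
      have y: "\<alpha> \<bullet> y \<noteq> 0" using that by (simp add: S_def)
      then have "(f y - f (refl_root \<alpha> y)) /\<^sub>R (\<alpha> \<bullet> y) - k *\<^sub>R D x \<alpha>
          = - ((f (refl_root \<alpha> y) + t *\<^sub>R D x \<alpha> - f y) /\<^sub>R (\<alpha> \<bullet> y))"
        by (simp add: t_def algebra_simps)
      then have "dist ((f y - f (refl_root \<alpha> y)) /\<^sub>R (\<alpha> \<bullet> y)) (k *\<^sub>R D x \<alpha>)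
          = norm (f (refl_root \<alpha> y) + t *\<^sub>R D x \<alpha> - f y) / \<bar>\<alpha> \<bullet> y\<bar>"
        by (simp add: dist_norm divide_inverse_commute)
      also have "\<dots> \<le> \<bar>t\<bar> * \<epsilon> / \<bar>\<alpha> \<bullet> y\<bar>"
        by (intro divide_right_mono bound) simp
      also have "\<dots> = e / 2"
        using y \<open>k > 0\<close> by (simp add: t_def \<epsilon>_def abs_mult)
      finally show ?thesis using \<open>e > 0\<close> by simp
    qed
    then show "\<forall>\<^sub>F y in at x within S.
        dist ((f y - f (refl_root \<alpha> y)) /\<^sub>R (\<alpha> \<bullet> y)) (k *\<^sub>R D x \<alpha>) < e"
      unfolding eventually_at using \<open>\<delta> > 0\<close> by blast
  qed
  \<comment> \<open>\<open>Lim\<close> is determined by convergence only along a nontrivial filter.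
    The points \<open>x + u *\<^sub>R \<alpha>\<close> approach \<open>x\<close> off the
    hyperplane.\<close>
  moreover have "at x within S \<noteq> bot"
  proof -
    have "x islimpt S"
      unfolding islimpt_approachable
    proof (intro allI impI)
      fix e :: real assume "e > 0"
      define u where "u = e / (2 * norm \<alpha>)"
      have "u > 0" using \<open>e > 0\<close> \<open>\<alpha> \<noteq> 0\<close> by (simp add: u_def)
      moreover have "dist (x + u *\<^sub>R \<alpha>) x < e"
        using \<open>e > 0\<close> \<open>\<alpha> \<noteq> 0\<close> by (simp add: dist_norm u_def)
      ultimately show "\<exists>y\<in>S. y \<noteq> x \<and> dist y x < e"
        using \<open>\<alpha> \<noteq> 0\<close> \<open>\<alpha> \<bullet> x = 0\<close>
        by (intro bexI[of _ "x + u *\<^sub>R \<alpha>"]) (auto simp: S_def inner_add_right)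
    qed
    then show ?thesis by (simp add: trivial_limit_within)
  qed
  ultimately show ?thesis
    using \<open>\<alpha> \<bullet> x = 0\<close> by (simp add: dunkl_quotient_def tendsto_Lim k_def S_def)
qed

text \<open>The reflection depends only on the line of the root, while the denominator changes sign.
  Multiplied by the likewise odd \<open>vec_cl \<alpha>\<close>, the quotient gives an even
  summand.\<close>

lemma dunkl_quotient_uminus:
  fixes f :: "real ^ 'm::finite \<Rightarrow> 'b::real_normed_vector"
  assumes f: "\<And>y. (f has_derivative D y) (at y)"
    and cont: "\<And>v. continuous_on UNIV (\<lambda>y. D y v)"
    and "\<alpha> \<noteq> 0"
  shows "dunkl_quotient (- \<alpha>) f x = - dunkl_quotient \<alpha> f x"
proof (cases "\<alpha> \<bullet> x = 0")
  case True
  interpret D: bounded_linear "D x" by (rule has_derivative_bounded_linear[OF f])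
  show ?thesis
    using True \<open>\<alpha> \<noteq> 0\<close> by (simp add: dunkl_quotient_hyperplane[OF f cont] D.neg)
next
  case False
  then show ?thesis by (simp add: dunkl_quotient_def refl_root_def)
qed

text \<open>Exchanging the sums collects the coordinates of each root into
  \<open>vec_cl \<alpha>\<close>, which frees the difference part of coordinates.\<close>

lemma dunkl_dirac_eq:
  assumes "(f has_derivative D) (at x)"
  shows "dunkl_dirac Rp \<kappa> f x
    = (\<Sum>i\<in>UNIV. gen i * D (axis i 1)) + (\<Sum>\<alpha>\<in>Rp. \<kappa> \<alpha> *\<^sub>R (vec_cl \<alpha> * dunkl_quotient \<alpha> f x))"
proof -
  have "dunkl_dirac Rp \<kappa> f x = (\<Sum>i\<in>UNIV. gen i * D (axis i 1))
      + (\<Sum>i\<in>UNIV. \<Sum>\<alpha>\<in>Rp. \<kappa> \<alpha> *\<^sub>R ((\<alpha> $ i) *\<^sub>R gen i * dunkl_quotient \<alpha> f x))"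
    by (simp add: dunkl_dirac_def dunkl_def partial_eq[OF assms] distrib_left sum.distrib
        sum_distrib_left)
  also have "(\<Sum>i\<in>UNIV. \<Sum>\<alpha>\<in>Rp. \<kappa> \<alpha> *\<^sub>R ((\<alpha> $ i) *\<^sub>R gen i * dunkl_quotient \<alpha> f x))
      = (\<Sum>\<alpha>\<in>Rp. \<kappa> \<alpha> *\<^sub>R (vec_cl \<alpha> * dunkl_quotient \<alpha> f x))"
    by (subst sum.swap) (simp add: vec_cl_def sum_distrib_right scaleR_sum_right)
  finally show ?thesis .
qed

section \<open>Equivariance\<close>

lemma linear_clifford_times: "linear (\<lambda>b. a * b)" for a :: "'m::{finite,linorder} clifford"
  by (rule linearI) (simp_all add: distrib_left)

lemma pin_action_has_derivative:
  assumes "s \<in> Pin" "(f has_derivative D) (at (pin_cover (cl_inv s) x))"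
  shows "(pin_action s f has_derivative (\<lambda>v. s * D (pin_cover (cl_inv s) v))) (at x)"
proof -
  have "bounded_linear (pin_cover (cl_inv s))"
    using assms(1) by (simp add: linear_pin_cover cl_inv_in_Pin linear_conv_bounded_linear[symmetric])
  then have "(pin_cover (cl_inv s) has_derivative pin_cover (cl_inv s)) (at x)"
    by (rule bounded_linear_imp_has_derivative)
  then have "((\<lambda>x. f (pin_cover (cl_inv s) x)) has_derivative (\<lambda>v. D (pin_cover (cl_inv s) v))) (at x)"
    by (rule has_derivative_compose) (rule assms(2))
  moreover have "bounded_linear (\<lambda>b. s * b)"
    using linear_clifford_times linear_conv_bounded_linear by blast
  ultimately show ?thesis
    unfolding pin_action_def[abs_def] by (metis bounded_linear.has_derivative)
qed

text \<open>Off the hyperplane the isometry preserves the denominator and conjugates the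
  reflections. On it, both limits are directional derivatives, related by the chain rule.\<close>

lemma dunkl_quotient_pin_action:
  assumes s: "s \<in> Pin"
    and f: "\<And>y. (f has_derivative D y) (at y)"
    and cont: "\<And>v. continuous_on UNIV (\<lambda>y. D y v)"
    and "\<alpha> \<noteq> 0"
  shows "dunkl_quotient \<alpha> (pin_action s f) x
    = s * dunkl_quotient (pin_cover (cl_inv s) \<alpha>) f (pin_cover (cl_inv s) x)"
proof -
  let ?g = "pin_cover (cl_inv s)"
  note s' = cl_inv_in_Pin[OF s]
  have g: "?g \<alpha> \<bullet> ?g x = \<alpha> \<bullet> x" "norm (?g \<alpha>) = norm \<alpha>"
    by (simp_all add: pin_cover_inner norm_pin_cover s')
  show ?thesis
  proof (cases "\<alpha> \<bullet> x = 0")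
    case True
    have "continuous_on UNIV ?g"
      using linear_pin_cover[OF s'] by (simp add: linear_continuous_on linear_conv_bounded_linear)
    \<comment> \<open>The hyperplane formula is to be applied to \<open>pin_action s f\<close>,
      whose derivative must therefore be continuous in direction \<open>\<alpha>\<close>.\<close>
    then have "continuous_on UNIV (\<lambda>y. D (?g y) (?g \<alpha>))"
      using continuous_on_compose2[OF cont] by blast
    then have "continuous_on UNIV (\<lambda>y. s * D (?g y) (?g \<alpha>))"
      by (rule linear_continuous_on_compose) (rule linear_clifford_times)
    then have "dunkl_quotient \<alpha> (pin_action s f) x = (2 / (norm \<alpha>)\<^sup>2) *\<^sub>R (s * D (?g x) (?g \<alpha>))"
      using True \<open>\<alpha> \<noteq> 0\<close> by (intro dunkl_quotient_hyperplane pin_action_has_derivative s f)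
    moreover have "?g \<alpha> \<noteq> 0" using \<open>\<alpha> \<noteq> 0\<close> g(2) by (metis norm_eq_zero)
    ultimately show ?thesis
      using True g by (simp add: dunkl_quotient_hyperplane[OF f cont])
  next
    case False
    then show ?thesis
      by (simp add: dunkl_quotient_def g pin_action_def pin_cover_refl_root s' right_diff_distrib)
  qed
qed

lemma sum_gen_times_pin_cover:
  assumes s: "s \<in> Pin" and "linear D"
  shows "(\<Sum>i\<in>UNIV. gen i * (s * D (pin_cover (cl_inv s) (axis i 1))))
    = pin_sgn s *\<^sub>R (s * (\<Sum>i\<in>UNIV. gen i * D (axis i 1)))"
proof -
  interpret D: linear D by fact
  let ?g = "pin_cover (cl_inv s)"
  have "D (?g v) = (\<Sum>j\<in>UNIV. (?g v $ j) *\<^sub>R D (axis j 1))" for v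
  proof -
    have "D (?g v) = D (\<Sum>j\<in>UNIV. (?g v $ j) *\<^sub>R axis j 1)"
      by (simp add: basis_expansion flip: scalar_mult_eq_scaleR)
    then show ?thesis by (simp add: D.sum D.scale)
  qed
  \<comment> \<open>The inverse of an orthogonal matrix is its transpose. Thus the sum over
    \<open>i\<close> reassembles the vector \<open>pin_cover s (axis j 1)\<close>, which is then
    moved past \<open>s\<close>.\<close>
  moreover have "?g (axis i 1) $ j = pin_cover s (axis j 1) $ i" for i j
    using pin_cover_adjoint[OF s, of "axis i 1" "axis j 1"]
    by (simp add: inner_axis inner_axis')
  ultimately have "(\<Sum>i\<in>UNIV. gen i * (s * D (?g (axis i 1))))
      = (\<Sum>i\<in>UNIV. \<Sum>j\<in>UNIV. (pin_cover s (axis j 1) $ i) *\<^sub>R gen i * (s * D (axis j 1)))"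
    by (simp add: sum_distrib_left)
  also have "\<dots> = (\<Sum>j\<in>UNIV. vec_cl (pin_cover s (axis j 1)) * s * D (axis j 1))"
    by (subst sum.swap) (simp add: vec_cl_def sum_distrib_right mult.assoc)
  also have "\<dots> = (\<Sum>j\<in>UNIV. pin_sgn s *\<^sub>R (s * (gen j * D (axis j 1))))"
  proof -
    have "vec_cl (axis j 1) = gen j" for j :: 'a
      by (simp add: vec_cl_def axis_def if_distrib if_distribR cong: if_cong)
    then show ?thesis by (simp add: vec_cl_pin_cover_times s mult.assoc)
  qed
  finally show ?thesis by (simp add: sum_distrib_left scaleR_sum_right)
qed

lemma pin_action_vec_mult:
  assumes "s \<in> Pin"
  shows "pin_action s (vec_mult f) x = pin_sgn s *\<^sub>R vec_mult (pin_action s f) x"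
proof -
  \<comment> \<open>The intertwining relation is taken at the preimage of \<open>x\<close>, where
    the action evaluates \<open>f\<close>.\<close>
  have "vec_cl x * s = pin_sgn s *\<^sub>R (s * vec_cl (pin_cover (cl_inv s) x))"
    using vec_cl_pin_cover_times[OF assms, of "pin_cover (cl_inv s) x"]
    by (simp add: pin_cover_cl_inv assms)
  then have "vec_mult (pin_action s f) x = pin_sgn s *\<^sub>R pin_action s (vec_mult f) x"
    by (simp add: vec_mult_def pin_action_def flip: mult.assoc)
  then show ?thesis by (simp add: pin_sgn_square assms)
qed

lemma dunkl_dirac_pin_action:
  assumes R: "reduced_root_system R" and Rp: "positive_subsystem R Rp"
    and \<kappa>: "multiplicity_function R \<kappa>" and s: "s \<in> pin_reflection_group R"
    and f: "\<And>y. (f has_derivative D y) (at y)"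
    and cont: "\<And>v. continuous_on UNIV (\<lambda>y. D y v)"
  shows "dunkl_dirac Rp \<kappa> (pin_action s f) x = pin_sgn s *\<^sub>R pin_action s (dunkl_dirac Rp \<kappa> f) x"
proof -
  have Pin: "s \<in> Pin" and G: "pin_cover s \<in> reflection_group R"
    using s by (auto simp: pin_reflection_group_def)
  let ?g = "pin_cover (cl_inv s)"
  \<comment> \<open>\<open>h\<close> and \<open>k\<close> are the root summands for the transformed
    function at \<open>x\<close> and for \<open>f\<close> at the preimage of
    \<open>x\<close>.\<close>
  define h where "h \<alpha> = \<kappa> \<alpha> *\<^sub>R (vec_cl \<alpha> * dunkl_quotient \<alpha> (pin_action s f) x)" for \<alpha>
  define k where "k \<alpha> = \<kappa> \<alpha> *\<^sub>R (vec_cl \<alpha> * dunkl_quotient \<alpha> f (?g x))" for \<alpha>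
  have nz: "\<alpha> \<noteq> 0" if "\<alpha> \<in> R" for \<alpha> using R that by (auto simp: reduced_root_system_def)
  \<comment> \<open>Indexing by the image of \<open>\<beta>\<close> undoes the inverse covering in
    the transformed quotient, so the summands match root by root.\<close>
  have h_eq: "h (pin_cover s \<beta>) = pin_sgn s *\<^sub>R (s * k \<beta>)" if "\<beta> \<in> R" for \<beta>
  proof -
    have "pin_cover s \<beta> \<noteq> 0" using nz[OF that] by (metis norm_pin_cover[OF Pin] norm_eq_zero)
    moreover have "\<kappa> (pin_cover s \<beta>) = \<kappa> \<beta>"
      using \<kappa> G that by (auto simp: multiplicity_function_def)
    ultimately have "h (pin_cover s \<beta>)
        = \<kappa> \<beta> *\<^sub>R (vec_cl (pin_cover s \<beta>) * s * dunkl_quotient \<beta> f (?g x))"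
      by (simp add: h_def dunkl_quotient_pin_action[OF Pin f cont] pin_cover_cl_inv Pin mult.assoc)
    then show ?thesis
      by (simp add: vec_cl_pin_cover_times Pin k_def mult.assoc)
  qed
  have k_even: "k (- \<beta>) = k \<beta>" if "\<beta> \<in> R" for \<beta>
    using that by (simp add: k_def multiplicity_function_uminus[OF R \<kappa>] nz
        dunkl_quotient_uminus[OF f cont] linear_neg[OF linear_vec_cl])
  have image: "pin_cover s ` R = R" by (rule reflection_group_image[OF R G])
  \<comment> \<open>Evenness is transported from \<open>k\<close>, because every root is an image of
    a root and the covering is linear.\<close>
  have h_even: "h (- \<alpha>) = h \<alpha>" if "\<alpha> \<in> R" for \<alpha>
  proof -
    have "\<alpha> \<in> pin_cover s ` R" using that by (simp add: image)
    then obtain \<beta> where \<beta>: "\<beta> \<in> R" "\<alpha> = pin_cover s \<beta>" by blast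
    moreover have "- \<beta> \<in> R" by (rule uminus_root[OF R \<beta>(1)])
    moreover have "- \<alpha> = pin_cover s (- \<beta>)" by (simp add: \<beta>(2) linear_neg[OF linear_pin_cover[OF Pin]])
    ultimately show ?thesis by (simp only: h_eq k_even)
  qed
  have inj: "inj_on (pin_cover s) R" by (metis inj_onI pin_cover_cl_inv(2)[OF Pin])
  have "2 *\<^sub>R sum h Rp = sum h R"
    by (rule sum_positive_subsystem[where h = h, OF R Rp h_even, symmetric])
  also have "\<dots> = (\<Sum>\<beta>\<in>R. h (pin_cover s \<beta>))"
    using sum.reindex[OF inj, of h] image by simp
  also have "\<dots> = pin_sgn s *\<^sub>R (s * sum k R)"
    by (simp add: h_eq sum_distrib_left scaleR_sum_right)
  also have "\<dots> = 2 *\<^sub>R (pin_sgn s *\<^sub>R (s * sum k Rp))"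
    by (simp add: sum_positive_subsystem[where h = k, OF R Rp k_even])
  finally have sums: "sum h Rp = pin_sgn s *\<^sub>R (s * sum k Rp)"
    by (simp only: scaleR_cancel_left) simp
  have "linear (D (?g x))" using f has_derivative_linear by blast
  then have "dunkl_dirac Rp \<kappa> (pin_action s f) x
      = pin_sgn s *\<^sub>R (s * (\<Sum>i\<in>UNIV. gen i * D (?g x) (axis i 1))) + sum h Rp"
    using dunkl_dirac_eq[OF pin_action_has_derivative[OF Pin f]]
    by (simp add: h_def sum_gen_times_pin_cover[OF Pin])
  then show ?thesis
    unfolding sums by (simp add: pin_action_def dunkl_dirac_eq[OF f] k_def distrib_left scaleR_add_right)
qed

theorem proposition3p2:
  fixes R Rp :: "(real, 'm::{finite,linorder}) vec set"
    and \<kappa> :: "(real, 'm) vec \<Rightarrow> real" and c :: real and s :: "'m clifford"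
  assumes "c > -1"
    and "reduced_root_system R" and "\<forall>\<alpha>\<in>R. \<alpha> \<bullet> \<alpha> = 2"
    and "positive_subsystem R Rp"
    and "multiplicity_function R \<kappa>"
    and "s \<in> pin_reflection_group R"
  shows "\<forall>f. smooth f \<longrightarrow>
      (\<forall>x. pin_action s (vec_mult f) x = pin_sgn s *\<^sub>R vec_mult (pin_action s f) x) \<and>
      (\<forall>x. x \<noteq> 0 \<longrightarrow>
        pin_action s (deformed_dirac Rp \<kappa> c f) x
          = pin_sgn s *\<^sub>R deformed_dirac Rp \<kappa> c (pin_action s f) x)"
proof (intro allI impI conjI)
  have s: "s \<in> Pin" using assms(6) by (simp add: pin_reflection_group_def)
  show "pin_action s (vec_mult f) x = pin_sgn s *\<^sub>R vec_mult (pin_action s f) x" for f x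
    by (rule pin_action_vec_mult[OF s])
  fix f :: "(real, 'm) vec \<Rightarrow> 'm clifford" and x :: "(real, 'm) vec"
  assume "smooth f"
  \<comment> \<open>The first level of smoothness supplies a derivative that is continuous in every
    direction.\<close>
  then have "C_k (Suc 0) f" unfolding smooth_def by blast
  then have diff: "f differentiable_on UNIV"
    and cont: "\<And>v. continuous_on UNIV (\<lambda>y. frechet_derivative f (at y) v)"
    by auto
  have f: "(f has_derivative frechet_derivative f (at y)) (at y)" for y
    using diff by (simp add: differentiable_on_def frechet_derivative_works)
  \<comment> \<open>The Euler operator commutes with the action without a sign; in the deformation
    term the sign comes from vector multiplication.\<close>
  have "euler (pin_action s f) x = pin_action s (euler f) x"
    using euler_eq[OF pin_action_has_derivative[OF s f]] by (simp add: euler_eq[OF f] pin_action_def)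
  then have "vec_mult (euler (pin_action s f)) x = vec_mult (pin_action s (euler f)) x"
    by (simp add: vec_mult_def)
  then have "pin_sgn s *\<^sub>R vec_mult (euler (pin_action s f)) x = pin_action s (vec_mult (euler f)) x"
    by (simp add: pin_action_vec_mult[OF s])
  moreover have "pin_sgn s *\<^sub>R dunkl_dirac Rp \<kappa> (pin_action s f) x
      = pin_action s (dunkl_dirac Rp \<kappa> f) x"
    using dunkl_dirac_pin_action[OF assms(2,4,5,6) f cont] by (simp add: pin_sgn_square[OF s])
  \<comment> \<open>The radial factor passes through the action because the covering preserves the
    norm.\<close>
  moreover have "pin_action s (deformed_dirac Rp \<kappa> c f) x = pin_action s (dunkl_dirac Rp \<kappa> f) x
      + (c / (norm x)\<^sup>2) *\<^sub>R pin_action s (vec_mult (euler f)) x"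
    by (simp add: pin_action_def deformed_dirac_def distrib_left norm_pin_cover cl_inv_in_Pin s)
  ultimately show "pin_action s (deformed_dirac Rp \<kappa> c f) x
      = pin_sgn s *\<^sub>R deformed_dirac Rp \<kappa> c (pin_action s f) x"
    by (simp only: deformed_dirac_def scaleR_add_right
        scaleR_left_commute[of "pin_sgn s" "c / (norm x)\<^sup>2"])
qed

end
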